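(* Let $\mathbf{T}=T_0T_1T_2\cdots$ be the Thue--Morse word over $\{0,1\}$. Then $\mathbf{Rdio}(\mathbf{T})\le 25$.
   Context: The Thue--Morse word $\mathbf{T}$ is the fixed point beginning with $0$ of the morphism $\varphi$ on the free semigroup generated by $\{0,1\}$ given by $\varphi(0)=01$, $\varphi(1)=10$; equivalently $T_n$ is the parity of the sum of the binary digits of $n$. For an infinite word $\mathbf{a}=a_0a_1a_2\cdots$ and integers $0\le r\le s$, $\mathbf{a}[r,s]$ denotes the finite word $a_ra_{r+1}\cdots a_s$. $(\epsilon,\delta)$-closeness: for two finite words $U=u_1\cdots u_L$ and $V=v_1\cdots v_L$ of the same length $L>0$, a real $\epsilon>0$ and an integer $\delta\ge 0$, $U$ and $V$ are $(\epsilon,\delta)$-close if there exist $\delta$ (possibly empty) subintervals $I_1,\dots,I_\delta$ of $\{1,\dots,L\}$ such that $\{1\le i\le L: u_i\ne v_i\}\subseteq \bigcup_{j=1}^{\delta} I_j$ and $\left|\bigcup_{j=1}^{\delta} I_j\right|\le \epsilon L$. Refined Diophantine exponent: for a real $\rho\ge 1$, $\mathbf{a}$ satisfies Condition $( * )_\rho$ if for every $\epsilon>0$ there exist three sequences of integers $(r_n)_{n\ge0}$, $(s_n)_{n\ge0}$, $(t_n)_{n\ge0}$ and an integer $\delta\ge0$ such that: $-1\le r_n<s_n<t_n$ for all $n$; $t_n\ge\rho s_n$ for all $n$; $s_n-r_n\to\infty$ as $n\to\infty$; and for all $n$ large enough, $\mathbf{a}[r_n+1,r_n+t_n-s_n]$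 and $\mathbf{a}[s_n+1,t_n]$ are $(\epsilon,\delta)$-close. The refined Diophantine exponent $\mathbf{Rdio}(\mathbf{a})\in[1,\infty]$ is the supremum of the $\rho$ for which $\mathbf{a}$ satisfies $( * )_\rho$. *)

theory Defs
  imports "HOL-Library.Extended_Real" "HOL-Library.Z2"
begin

text \<open>The alphabet \<open>{0, 1}\<close> is the type \<^typ>\<open>bit\<close>; an infinite word over \<open>'a\<close> is a function
  from \<^typ>\<open>nat\<close> to \<open>'a\<close>.\<close>

definition tm_image :: "bit \<Rightarrow> bit list" where
  "tm_image x = (if x = 0 then [0, 1] else [1, 0])"

definition tm_morphism :: "bit list \<Rightarrow> bit list" where
  "tm_morphism w = concat (map tm_image w)"

text \<open>The action on infinite words. The image of every letter is non-empty, so the letter of index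
  \<open>n\<close> of the image already occurs in the image of the prefix of length \<open>n + 1\<close>.\<close>

definition tm_morphism_inf :: "(nat \<Rightarrow> bit) \<Rightarrow> (nat \<Rightarrow> bit)" where
  "tm_morphism_inf a n = tm_morphism (map a [0..<Suc n]) ! n"

definition thue_morse :: "nat \<Rightarrow> bit" where
  "thue_morse = (THE a. a 0 = 0 \<and> tm_morphism_inf a = a)"

lemma tm_image_alt: "tm_image x = [x, x + 1]"
  by (cases x) (simp_all add: tm_image_def)

lemma length_tm_morphism: "length (tm_morphism w) = 2 * length w"
  by (induction w) (simp_all add: tm_morphism_def tm_image_alt)

lemma tm_morphism_nth:
  "n < 2 * length w \<Longrightarrow>
     tm_morphism w ! n = (if even n then w ! (n div 2) else w ! (n div 2) + 1)"
proof (induction w arbitrary: n)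
  case Nil
  then show ?case by simp
next
  case (Cons x w)
  have eq: "tm_morphism (x # w) = x # (x + 1) # tm_morphism w"
    by (simp add: tm_morphism_def tm_image_alt)
  consider "n = 0" | "n = 1" | m where "n = Suc (Suc m)"
    by (metis One_nat_def nat.exhaust)
  then show ?case
  proof cases
    case 3
    then show ?thesis using Cons.IH[of m] Cons.prems by (simp add: eq)
  qed (simp_all add: eq)
qed

lemma tm_morphism_inf_alt:
  "tm_morphism_inf a n = (if even n then a (n div 2) else a (n div 2) + 1)"
proof -
  have "n div 2 < Suc n" by simp
  then have "map a [0..<Suc n] ! (n div 2) = a (n div 2)"
    by (metis add.left_neutral diff_zero length_upt nth_map nth_upt)
  then show ?thesis
    unfolding tm_morphism_inf_def by (subst tm_morphism_nth) (simp_all del: upt_Suc)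
qed

fun digit_sum_parity :: "nat \<Rightarrow> bit" where
  "digit_sum_parity n = (if n = 0 then 0 else digit_sum_parity (n div 2) + of_nat (n mod 2))"

declare digit_sum_parity.simps [simp del]

lemma tm_fixed_point_iff:
  "a 0 = 0 \<and> tm_morphism_inf a = a \<longleftrightarrow> a = digit_sum_parity"
proof
  assume A: "a 0 = 0 \<and> tm_morphism_inf a = a"
  have "a n = digit_sum_parity n" for n
  proof (induction n rule: less_induct)
    case (less n)
    show ?case
    proof (cases "n = 0")
      case True
      then show ?thesis using A by (simp add: digit_sum_parity.simps)
    next
      case False
      have "a n = (if even n then a (n div 2) else a (n div 2) + 1)"
        using A tm_morphism_inf_alt[of a n] by simp
      then show ?thesis
        using less[of "n div 2"] False
        by (subst digit_sum_parity.simps) (auto simp: odd_iff_mod_2_eq_one even_iff_mod_2_eq_zero)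
    qed
  qed
  then show "a = digit_sum_parity" by blast
next
  assume A: "a = digit_sum_parity"
  have "tm_morphism_inf a n = a n" for n
    unfolding A tm_morphism_inf_alt
    by (subst (3) digit_sum_parity.simps)
      (auto simp: digit_sum_parity.simps[of 0] odd_iff_mod_2_eq_one even_iff_mod_2_eq_zero)
  then show "a 0 = 0 \<and> tm_morphism_inf a = a"
    using A by (auto simp: digit_sum_parity.simps[of 0])
qed

lemma thue_morse_eq_digit_sum_parity: "thue_morse = digit_sum_parity"
  unfolding thue_morse_def tm_fixed_point_iff by simp

lemma thue_morse_fixed_point: "thue_morse 0 = 0" "tm_morphism_inf thue_morse = thue_morse"
  using tm_fixed_point_iff[of thue_morse] by (simp_all add: thue_morse_eq_digit_sum_parity)

text \<open>The factor \<open>a\<^sub>r \<dots> a\<^sub>s\<close>, used only for \<open>0 \<le> r \<le> s\<close>. The indices are integers because the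
  condition below allows the value \<open>-1\<close> for \<open>r\<^sub>n\<close>.\<close>

definition factor :: "(nat \<Rightarrow> 'a) \<Rightarrow> int \<Rightarrow> int \<Rightarrow> 'a list" where
  "factor a r s = map (\<lambda>i. a (nat i)) [r..s]"

definition subinterval :: "nat \<Rightarrow> nat set \<Rightarrow> bool" where
  "subinterval L I \<longleftrightarrow> I \<subseteq> {1..L} \<and> (\<exists>x y. I = {x..y})"

text \<open>Positions are counted from 1, list indices from 0.\<close>

definition close_words :: "real \<Rightarrow> nat \<Rightarrow> 'a list \<Rightarrow> 'a list \<Rightarrow> bool" where
  "close_words \<epsilon> \<delta> U V \<longleftrightarrow>
     length U = length V \<and> 0 < length U \<and>
     (\<exists>I :: nat \<Rightarrow> nat set.
        (\<forall>j\<in>{1..\<delta>}. subinterval (length U) (I j)) \<and>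
        {i \<in> {1..length U}. U ! (i - 1) \<noteq> V ! (i - 1)} \<subseteq> (\<Union>j\<in>{1..\<delta>}. I j) \<and>
        real (card (\<Union>j\<in>{1..\<delta>}. I j)) \<le> \<epsilon> * real (length U))"

definition condition_star :: "real \<Rightarrow> (nat \<Rightarrow> 'a) \<Rightarrow> bool" where
  "condition_star \<rho> a \<longleftrightarrow>
     (\<forall>\<epsilon>>0. \<exists>(r :: nat \<Rightarrow> int) (s :: nat \<Rightarrow> int) (t :: nat \<Rightarrow> int) (\<delta> :: nat).
        (\<forall>n. -1 \<le> r n \<and> r n < s n \<and> s n < t n) \<and>
        (\<forall>n. real_of_int (t n) \<ge> \<rho> * real_of_int (s n)) \<and>
        filterlim (\<lambda>n. s n - r n) at_top sequentially \<and>
        (\<forall>\<^sub>F n in sequentially.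
           close_words \<epsilon> \<delta> (factor a (r n + 1) (r n + t n - s n)) (factor a (s n + 1) (t n))))"

definition Rdio :: "(nat \<Rightarrow> 'a) \<Rightarrow> ereal" where
  "Rdio a = Sup {ereal \<rho> | \<rho>. 1 \<le> \<rho> \<and> condition_star \<rho> a}"

text \<open>Over a finite alphabet the supremum is taken over a non-empty set: some letter occurs
  infinitely often, and the condition for \<open>\<rho> = 1\<close> is met by factors of length 1.\<close>

lemma condition_star_1:
  fixes a :: "nat \<Rightarrow> 'a :: finite"
  shows "condition_star 1 a"
proof -
  obtain m where "infinite {n. a n = a m}"
    using pigeonhole_infinite[of UNIV a] by auto
  then obtain y where inf: "infinite {n. a n = y}" by auto
  define p where "p = enumerate {n. a n = y}"
  have p: "a (p n) = y" for n
    using enumerate_in_set[OF inf] by (auto simp: p_def)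
  have mono: "strict_mono p"
    using inf by (simp add: p_def strict_mono_enumerate)
  define r s t :: "nat \<Rightarrow> int"
    where "r n = int (p 0) - 1" and "s n = int (p (Suc n)) - 1" and "t n = int (p (Suc n))" for n
  have ge: "int n \<le> s n" for n
    using strict_mono_imp_increasing[OF mono, of "Suc n"] by (simp add: s_def)
  have lim: "filterlim (\<lambda>n. s n - r n) at_top sequentially"
    unfolding filterlim_at_top
  proof
    fix Z
    show "\<forall>\<^sub>F n in sequentially. Z \<le> s n - r n"
      using eventually_ge_at_top[of "nat (Z + int (p 0))"]
    proof eventually_elim
      case (elim n)
      then show ?case using ge[of n] by (simp add: r_def)
    qed
  qed
  have ord: "-1 \<le> r n \<and> r n < s n \<and> s n < t n" for n
    using strict_monoD[OF mono, of 0 "Suc n"] by (simp add: r_def s_def t_def)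
  have cl: "close_words \<epsilon> 0 (factor a (r n + 1) (r n + t n - s n)) (factor a (s n + 1) (t n))"
    if "\<epsilon> > 0" for \<epsilon> n
    using that by (simp add: close_words_def factor_def r_def s_def t_def p)
  have ge1: "\<forall>n. real_of_int (t n) \<ge> 1 * real_of_int (s n)"
    by (simp add: s_def t_def)
  show ?thesis
    unfolding condition_star_def
    by (intro allI impI exI[of _ r] exI[of _ s] exI[of _ t] exI[of _ 0])
      (use ord lim cl ge1 in \<open>auto intro: always_eventually\<close>)
qed

lemma Rdio_ge_1: "1 \<le> Rdio (a :: nat \<Rightarrow> 'a :: finite)"
  unfolding Rdio_def using condition_star_1[of a]
  by (intro Sup_upper) (auto simp: one_ereal_def)

end

theory Submission
  imports Defs
begin

text \<open>Suppose \<open>2 ^ k \<le> h < 2 ^ (k + 1)\<close>. For fixed \<open>j < 2 ^ k\<close> the difference of the letters of index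
  \<open>2 ^ k * q + j\<close> and \<open>2 ^ k * q + j + h\<close> is, up to a constant depending on \<open>j\<close> only, the difference
  of the letters of index \<open>q\<close> and \<open>q + c\<close> with \<open>c \<in> {1, 2}\<close>, and the latter takes both values among any
  eight consecutive \<open>q\<close>. Hence the shift by \<open>h\<close> produces at least \<open>2 ^ k\<close> mismatches in every
  window of length \<open>9 * 2 ^ k \<le> 9 * h\<close>, so that a positive proportion of the letters differ
  as soon as \<open>t\<^sub>n - s\<^sub>n \<ge> 9 * (s\<^sub>n - r\<^sub>n)\<close>.\<close>

lemma thue_morse_even: "thue_morse (2 * n) = thue_morse n"
  and thue_morse_odd: "thue_morse (Suc (2 * n)) = thue_morse n + 1"
  using tm_morphism_inf_alt[of thue_morse "2 * n"] tm_morphism_inf_alt[of thue_morse "Suc (2 * n)"]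
  by (simp_all add: thue_morse_fixed_point)

text \<open>For \<open>j < 2 ^ k\<close> the binary digits of \<open>2 ^ k * q + j\<close> are those
  of \<open>q\<close> followed by those of \<open>j\<close> padded to length \<open>k\<close>, so
  digit sums add. The induction strips the last digit of \<open>j\<close>.\<close>

lemma thue_morse_block:
  "j < 2 ^ k \<Longrightarrow> thue_morse (2 ^ k * q + j) = thue_morse q + thue_morse j"
proof (induction k arbitrary: j)
  case 0
  then show ?case by (simp add: thue_morse_fixed_point)
next
  case (Suc k)
  define i where "i = j div 2"
  have IH: "thue_morse (2 ^ k * q + i) = thue_morse q + thue_morse i"
    using Suc by (simp add: i_def)
  show ?case
  proof (cases "even j")
    case True
    then have j: "j = 2 * i" by (simp add: i_def)
    have "2 ^ Suc k * q + j = 2 * (2 ^ k * q + i)" by (simp add: j)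
    then show ?thesis by (simp only: thue_morse_even IH j)
  next
    case False
    then have j: "j = Suc (2 * i)" by (simp add: i_def)
    have "2 ^ Suc k * q + j = Suc (2 * (2 ^ k * q + i))" by (simp add: j)
    then show ?thesis by (simp only: thue_morse_odd IH j add.assoc)
  qed
qed

text \<open>The four letters from index \<open>4 * p\<close> on are x, x + 1, x + 1, x: the inner
  two agree, while those at \<open>2 * p\<close> and \<open>2 * p + 1\<close> always differ.\<close>

lemma ex_thue_morse_add_next: "\<exists>q\<in>{n..<n + 4}. thue_morse q + thue_morse (q + 1) = b"
proof (cases b)
  case zero
  \<comment> \<open>The least \<open>p\<close> with \<open>n \<le> 4 * p + 1\<close>; in the other
    case, the least with \<open>n \<le> 2 * p\<close>.\<close>
  define p where "p = (n + 2) div 4"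
  have "thue_morse (4 * p + 1) = thue_morse p + 1"
    using thue_morse_odd[of "2 * p"] thue_morse_even[of p] by simp
  moreover have "thue_morse (4 * p + 1 + 1) = thue_morse p + 1"
    using thue_morse_even[of "2 * p + 1"] thue_morse_odd[of p] by simp
  ultimately have "thue_morse (4 * p + 1) + thue_morse (4 * p + 1 + 1) = b"
    using zero by simp
  moreover have "4 * p + 1 \<in> {n..<n + 4}"
    unfolding p_def atLeastLessThan_iff by presburger
  ultimately show ?thesis by blast
next
  case one
  define p where "p = (n + 1) div 2"
  have "thue_morse (2 * p) + thue_morse (2 * p + 1) = b"
    using one thue_morse_odd[of p] thue_morse_even[of p] by (simp flip: add.assoc)
  moreover have "2 * p \<in> {n..<n + 4}"
    unfolding p_def atLeastLessThan_iff by presburger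
  ultimately show ?thesis by blast
qed

text \<open>The letters of even index reproduce the word, so taking \<open>q\<close> even reduces
  the shift 2 to the shift 1. Four consecutive halves fit into eight consecutive indices.\<close>

lemma ex_thue_morse_add_shift:
  assumes "c = 1 \<or> c = 2"
  shows "\<exists>q\<in>{n..<n + 8}. thue_morse q + thue_morse (q + c) = b"
  using assms
proof
  assume "c = 1"
  then show ?thesis using ex_thue_morse_add_next[of n b] by auto
next
  assume c: "c = 2"
  obtain p where p: "p \<in> {(n + 1) div 2..<(n + 1) div 2 + 4}"
      "thue_morse p + thue_morse (p + 1) = b"
    using ex_thue_morse_add_next by blast
  have "thue_morse (2 * p) + thue_morse (2 * p + c) = b"
    using p(2) c thue_morse_even[of p] thue_morse_even[of "p + 1"] by simp
  moreover have "2 * p \<in> {n..<n + 8}"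
    using p(1) unfolding atLeastLessThan_iff by presburger
  ultimately show ?thesis by blast
qed

lemma ex_thue_morse_mismatch:
  assumes h: "2 ^ k \<le> h" "h < 2 ^ Suc k" and j: "j < 2 ^ k"
  shows "\<exists>i\<in>{a..<a + 9 * 2 ^ k}. i mod 2 ^ k = j \<and> thue_morse i \<noteq> thue_morse (i + h)"
proof -
  define K :: nat where "K = 2 ^ k"
  have K: "K > 0" by (simp add: K_def)
  define c where "c = (j + h) div K"
  define m where "m = (j + h) mod K"
  \<comment> \<open>The quotient of \<open>a\<close> by \<open>K\<close>, rounded up: the first
    block of length \<open>K\<close> that starts at or after \<open>a\<close>.\<close>
  define q0 where "q0 = (a + K - 1) div K"
  have jh: "j + h = K * c + m" by (simp add: c_def m_def)
  have m: "m < K" using K by (simp add: m_def)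
  \<comment> \<open>Because \<open>K \<le> h < 2 * K\<close> and \<open>j < K\<close>, the sum
    \<open>j + h\<close> lies in \<open>[K, 3 * K)\<close>.\<close>
  have "1 \<le> c" "c < 3"
    using h j K by (simp_all add: c_def K_def less_eq_div_iff_mult_less_eq div_less_iff_less_mult)
  then have "c = 1 \<or> c = 2" by auto
  \<comment> \<open>By \<open>thue_morse_block\<close> this value of the sum is exactly what makes
    the letters at \<open>K * q + j\<close> and \<open>K * (q + c) + m\<close> differ.\<close>
  then obtain q where q: "q \<in> {q0..<q0 + 8}"
      "thue_morse q + thue_morse (q + c) = thue_morse j + thue_morse m + 1"
    using ex_thue_morse_add_shift by blast
  define i where "i = K * q + j"
  have "i + h = K * (q + c) + m" using jh by (simp add: i_def algebra_simps)
  then have "thue_morse (i + h) = thue_morse (q + c) + thue_morse m"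
    using m thue_morse_block by (simp add: K_def)
  moreover have "thue_morse i = thue_morse q + thue_morse j"
    using j thue_morse_block by (simp add: i_def K_def)
  ultimately have "thue_morse i \<noteq> thue_morse (i + h)"
    using q(2) by (cases "thue_morse q"; cases "thue_morse j"; cases "thue_morse m";
        cases "thue_morse (q + c)") auto
  moreover have "i mod K = j" using j by (simp add: i_def K_def)
  moreover have "a \<le> K * q0" "K * q0 < a + K"
  proof -
    have "K * q0 + (a + K - 1) mod K = a + K - 1"
      by (simp add: q0_def)
    moreover have "(a + K - 1) mod K < K" using K by simp
    ultimately show "a \<le> K * q0" "K * q0 < a + K" using K by linarith+
  qed
  moreover have "K * q0 \<le> K * q" "K * q \<le> K * q0 + 7 * K"
  proof -
    show "K * q0 \<le> K * q" using q(1) by simp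
    have "K * q \<le> K * (q0 + 7)" using q(1) by (intro mult_le_mono2) auto
    then show "K * q \<le> K * q0 + 7 * K" by (simp add: algebra_simps)
  qed
  \<comment> \<open>The nine blocks: less than one for rounding \<open>a\<close> up, at most seven
    from \<open>q0\<close> to \<open>q\<close>, less than one for \<open>j\<close>.\<close>
  ultimately have "a \<le> i" "i < a + 9 * K" "i mod K = j" "thue_morse i \<noteq> thue_morse (i + h)"
    using j unfolding i_def K_def[symmetric] by linarith+
  then show ?thesis unfolding K_def by (intro bexI[of _ i]) simp_all
qed

text \<open>Every residue modulo \<open>2 ^ k\<close> is attained by a mismatch, so reduction modulo
  \<open>2 ^ k\<close> maps the mismatches onto a set of size \<open>2 ^ k\<close>.\<close>

lemma card_thue_morse_mismatch_window:
  assumes "2 ^ k \<le> h" "h < 2 ^ Suc k"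
  shows "2 ^ k \<le> card {i\<in>{a..<a + 9 * 2 ^ k}. thue_morse i \<noteq> thue_morse (i + h)}"
    (is "_ \<le> card ?M")
proof -
  have "{..<2 ^ k} \<subseteq> (\<lambda>i. i mod 2 ^ k) ` ?M"
  proof
    fix j :: nat assume "j \<in> {..<2 ^ k}"
    then obtain i where "i \<in> ?M" "i mod 2 ^ k = j"
      using ex_thue_morse_mismatch[OF assms, of j a] by blast
    then show "j \<in> (\<lambda>i. i mod 2 ^ k) ` ?M" by blast
  qed
  then have "card {..<(2 :: nat) ^ k} \<le> card ?M"
    by (intro surj_card_le) auto
  then show ?thesis by simp
qed

lemma card_thue_morse_mismatch_windows:
  assumes "2 ^ k \<le> h" "h < 2 ^ Suc k"
  shows "N * 2 ^ k \<le> card {i\<in>{a..<a + N * (9 * 2 ^ k)}. thue_morse i \<noteq> thue_morse (i + h)}"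
proof (induction N)
  case (Suc N)
  let ?M = "\<lambda>x y. {i\<in>{x..<y}. thue_morse i \<noteq> thue_morse (i + h)}"
  let ?b = "a + N * (9 * 2 ^ k)" and ?c = "a + Suc N * (9 * 2 ^ k)"
  have "?M a ?c = ?M a ?b \<union> ?M ?b ?c" by auto
  then have "card (?M a ?c) = card (?M a ?b \<union> ?M ?b ?c)" by (rule arg_cong)
  also have "\<dots> = card (?M a ?b) + card (?M ?b ?c)"
    by (rule card_Un_disjoint) auto
  finally have "card (?M a ?c) = card (?M a ?b) + card (?M ?b ?c)" .
  moreover have "?c = ?b + 9 * 2 ^ k" by simp
  then have "2 ^ k \<le> card (?M ?b ?c)"
    using card_thue_morse_mismatch_window[OF assms, of ?b] by (simp only:)
  moreover have "Suc N * 2 ^ k = N * 2 ^ k + 2 ^ k" by simp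
  ultimately show ?case using Suc by linarith
qed simp

text \<open>Full windows have mismatch density at least 1/9. At least one window fits, and the
  remainder is shorter than a window, so the full windows fill more than half of the range; hence
  1/18.\<close>

lemma card_thue_morse_mismatch:
  assumes h: "0 < h" and L: "9 * h \<le> L"
  shows "L < 18 * card {i\<in>{a..<a + L}. thue_morse i \<noteq> thue_morse (i + h)}"
proof -
  obtain k where k: "2 ^ k \<le> h" "h < 2 ^ Suc k"
    using ex_power_ivl1[of 2 h] h by auto
  define W :: nat where "W = 9 * 2 ^ k"
  define N where "N = L div W"
  have W: "0 < W" "W \<le> L" using k L by (auto simp: W_def)
  have L_eq: "L = N * W + L mod W" by (simp add: N_def)
  have "L mod W < W" using W by simp
  moreover have "1 \<le> N" using W by (simp add: N_def less_eq_div_iff_mult_less_eq)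
  then have "W \<le> N * W" by simp
  ultimately have "L < 2 * (N * W)" using L_eq by linarith
  also have "\<dots> = 18 * (N * 2 ^ k)" by (simp add: W_def)
  also have "N * 2 ^ k \<le> card {i\<in>{a..<a + N * W}. thue_morse i \<noteq> thue_morse (i + h)}"
    unfolding W_def by (rule card_thue_morse_mismatch_windows[OF k])
  also have "\<dots> \<le> card {i\<in>{a..<a + L}. thue_morse i \<noteq> thue_morse (i + h)}"
    by (intro card_mono) (auto simp: N_def intro: order_less_le_trans)
  finally show ?thesis by simp
qed

text \<open>Turns closeness into an upper bound on the mismatch density, to be set against the lower
  bound 1/18.\<close>

lemma card_mismatch_close_words:
  assumes "close_words \<epsilon> \<delta> U V"
  shows "real (card {i. i < length U \<and> U ! i \<noteq> V ! i}) \<le> \<epsilon> * real (length U)"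
proof -
  obtain I where I: "\<forall>j\<in>{1..\<delta>}. subinterval (length U) (I j)"
      "{i \<in> {1..length U}. U ! (i - 1) \<noteq> V ! (i - 1)} \<subseteq> (\<Union>j\<in>{1..\<delta>}. I j)"
      "real (card (\<Union>j\<in>{1..\<delta>}. I j)) \<le> \<epsilon> * real (length U)"
    using assms unfolding close_words_def by blast
  have "finite (\<Union>j\<in>{1..\<delta>}. I j)"
    using I(1) by (auto simp: subinterval_def)
  moreover have "Suc ` {i. i < length U \<and> U ! i \<noteq> V ! i} \<subseteq> (\<Union>j\<in>{1..\<delta>}. I j)"
    by (rule order_trans[OF _ I(2)]) auto
  ultimately have "card (Suc ` {i. i < length U \<and> U ! i \<noteq> V ! i}) \<le> card (\<Union>j\<in>{1..\<delta>}. I j)"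
    by (rule card_mono)
  then have "card {i. i < length U \<and> U ! i \<noteq> V ! i} \<le> card (\<Union>j\<in>{1..\<delta>}. I j)"
    by (simp only: card_image[OF inj_Suc])
  then show ?thesis using I(3) by linarith
qed

lemma length_factor: "length (factor a r s) = nat (s - r + 1)"
  by (simp add: factor_def)

lemma factor_nth: "i < nat (s - r + 1) \<Longrightarrow> factor a r s ! i = a (nat (r + int i))"
  by (simp add: factor_def)

lemma not_condition_star_thue_morse:
  assumes "\<rho> > 25"
  shows "\<not> condition_star \<rho> thue_morse"
proof
  assume "condition_star \<rho> thue_morse"
  then have "condition_star \<rho> thue_morse" "(0 :: real) < 1 / 18" by simp_all
  then obtain r s t :: "nat \<Rightarrow> int" and \<delta> where ord: "\<And>n. -1 \<le> r n \<and> r n < s n \<and> s n < t n"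
    and t: "\<And>n. real_of_int (t n) \<ge> \<rho> * real_of_int (s n)"
    and lim: "filterlim (\<lambda>n. s n - r n) at_top sequentially"
    and cl: "\<forall>\<^sub>F n in sequentially. close_words (1 / 18) \<delta>
      (factor thue_morse (r n + 1) (r n + t n - s n)) (factor thue_morse (s n + 1) (t n))"
    unfolding condition_star_def by blast
  \<comment> \<open>With \<open>r n \<ge> -1\<close> this forces \<open>s n \<ge> 1\<close>, so that
    \<open>9 * (s n - r n) \<le> 9 * (s n + 1) \<le> 24 * s n \<le> t n - s n\<close>. This is where
    25 suffices.\<close>
  from lim have "\<forall>\<^sub>F n in sequentially. 2 \<le> s n - r n"
    by (simp add: filterlim_at_top)
  with cl have "\<forall>\<^sub>F n in sequentially. False"
  proof eventually_elim
    case (elim n)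
    \<comment> \<open>Exact, since \<open>r n \<ge> -1\<close>; the value -1 gives
      \<open>a = 0\<close>.\<close>
    define a where "a = nat (r n + 1)"
    define h where "h = nat (s n - r n)"
    define L where "L = nat (t n - s n)"
    let ?U = "factor thue_morse (r n + 1) (r n + t n - s n)"
    let ?V = "factor thue_morse (s n + 1) (t n)"
    have s: "0 \<le> s n" using ord[of n] by linarith
    have "25 * real_of_int (s n) \<le> \<rho> * real_of_int (s n)"
      using assms s by (intro mult_right_mono) auto
    then have t': "25 * s n \<le> t n" using t[of n] by linarith
    have h: "0 < h" "9 * h \<le> L"
      using ord[of n] elim(2) t' by (auto simp: h_def L_def)
    have len: "length ?U = L" by (simp add: length_factor L_def)
    have nth: "?U ! i = thue_morse (a + i)" "?V ! i = thue_morse (a + i + h)" if "i < L" for i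
    proof -
      have "nat (r n + 1 + int i) = a + i" "nat (s n + 1 + int i) = a + i + h"
        using ord[of n] by (auto simp: a_def h_def)
      then show "?U ! i = thue_morse (a + i)" "?V ! i = thue_morse (a + i + h)"
        using that by (auto simp: factor_nth L_def)
    qed
    \<comment> \<open>Comparing the two factors letter by letter is comparing the word with its
      shift by \<open>h\<close> on a range of length \<open>L\<close> starting at
      \<open>a\<close>.\<close>
    have "{i\<in>{a..<a + L}. thue_morse i \<noteq> thue_morse (i + h)}
        = (+) a ` {i. i < L \<and> ?U ! i \<noteq> ?V ! i}" (is "?M = _")
    proof (intro equalityI subsetI)
      fix i assume i: "i \<in> ?M"
      then have "i - a < L" by auto
      with i show "i \<in> (+) a ` {i. i < L \<and> ?U ! i \<noteq> ?V ! i}"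
        using nth[of "i - a"] by (intro image_eqI[of _ _ "i - a"]) auto
    qed (use nth in auto)
    then have "card ?M = card {i. i < L \<and> ?U ! i \<noteq> ?V ! i}"
      by (simp add: card_image)
    moreover have "real (card {i. i < L \<and> ?U ! i \<noteq> ?V ! i}) \<le> 1 / 18 * real L"
      using card_mismatch_close_words[OF elim(1)] unfolding len .
    moreover have "L < 18 * card ?M"
      by (rule card_thue_morse_mismatch[OF h])
    ultimately show False by linarith
  qed
  then show False by simp
qed

theorem theorem6p1:
  shows "Rdio thue_morse \<le> 25"
  unfolding Rdio_def
proof (rule Sup_least)
  fix x assume "x \<in> {ereal \<rho> | \<rho>. 1 \<le> \<rho> \<and> condition_star \<rho> thue_morse}"
  then obtain \<rho> where "x = ereal \<rho>" "condition_star \<rho> thue_morse" by auto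
  then show "x \<le> 25"
    using not_condition_star_thue_morse[of \<rho>] by (cases "\<rho> > 25") auto
qed

end
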